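(* Let $n \geqslant m \geqslant 1$ be integers and let $\sigma^m = [\upsilon^0, \upsilon^1, \ldots, \upsilon^m]$ be an $m$-simplex in $\mathbb{R}^n$ with barycenter $\kappa^m$. For $i=0,\ldots,m$ let $\kappa_i^m$ be the barycenter of the $i$-th $(m-1)$-face of $\sigma^m$ (opposite to $\upsilon^i$) and let $\mu_i^m=[\upsilon^i,\kappa_i^m]$ be the $i$-th median. Then $$\sum_{i=0}^{m}\|\mu_i^m\|^2 = \frac{m+1}{m^2}\sum_{p=0}^{m-1}\sum_{q=p+1}^{m}\|\upsilon^p-\upsilon^q\|^2$$ and $$\sum_{i=0}^{m}\|\kappa^m-\upsilon^i\|^2 = \frac{1}{m+1}\sum_{p=0}^{m-1}\sum_{q=p+1}^{m}\|\upsilon^p-\upsilon^q\|^2.$$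
   Context: An $m$-simplex $[\upsilon^0,\ldots,\upsilon^m]$ in $\mathbb{R}^n$ is the convex hull of $m+1$ affinely independent points (its vertices). Its barycenter is $\kappa^m=\frac1{m+1}\sum_{j=0}^m\upsilon^j$. The $i$-th $(m-1)$-face is the convex hull of all vertices except $\upsilon^i$, and its barycenter is $\kappa_i^m = \frac1m\sum_{j\neq i}\upsilon^j$. The length of the $i$-th median is $\|\mu_i^m\|=\|\upsilon^i-\kappa_i^m\|$, where $\|\cdot\|$ is the Euclidean norm. *)

theory Defs
  imports "HOL-Analysis.Analysis"
begin

text \<open>
  The library predicate \<open>m simplex S\<close> hides the vertices behind an existential quantifier. Since
  medians and barycenters are indexed by the vertices, we work with a simplex together with an
  enumeration of its vertices \<open>v 0, \<dots>, v m\<close>; values of \<open>v\<close> beyond \<open>m\<close> are irrelevant.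
  The library's affine (in)dependence is a property of sets, so affine independence of the family
  is injectivity plus affine independence of the image.
\<close>

definition is_simplex :: "nat \<Rightarrow> (nat \<Rightarrow> 'a::euclidean_space) \<Rightarrow> 'a set \<Rightarrow> bool" where
  "is_simplex m v \<sigma> \<longleftrightarrow>
     inj_on v {0..m} \<and> \<not> affine_dependent (v ` {0..m}) \<and> \<sigma> = convex hull (v ` {0..m})"

lemma is_simplex_imp_simplex:
  assumes "is_simplex m v \<sigma>"
  shows "int m simplex \<sigma>"
  using assms unfolding is_simplex_def simplex_def
  by (intro exI[of _ "v ` {0..m}"]) (auto simp: card_image)

definition barycenter :: "nat \<Rightarrow> (nat \<Rightarrow> 'a::real_vector) \<Rightarrow> 'a" where
  "barycenter m v = (1 / (real m + 1)) *\<^sub>R (\<Sum>j=0..m. v j)"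

text \<open>Barycenter of the face opposite to \<open>v i\<close>; meaningful for \<open>m \<ge> 1\<close> and \<open>i \<le> m\<close>.\<close>

definition face_barycenter :: "nat \<Rightarrow> (nat \<Rightarrow> 'a::real_vector) \<Rightarrow> nat \<Rightarrow> 'a" where
  "face_barycenter m v i = (1 / real m) *\<^sub>R (\<Sum>j\<in>{0..m} - {i}. v j)"

text \<open>Length of the median, the segment from \<open>v i\<close> to the barycenter of the opposite face.\<close>

definition median_length :: "nat \<Rightarrow> (nat \<Rightarrow> 'a::real_normed_vector) \<Rightarrow> nat \<Rightarrow> real" where
  "median_length m v i = norm (v i - face_barycenter m v i)"

end

theory Submission
  imports Defs
begin

text \<open>
  Both sums reduce to \<open>(m + 1) \<Sum>i |v i|\<^sup>2 - |\<Sum>i v i|\<^sup>2\<close>, which equals the sum of the squared edge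
  lengths. The medians are the dilations of the segments from the vertices to the barycenter by
  the factor \<open>(m + 1) / m\<close>.
\<close>

text \<open>The point \<open>c\<close> is arbitrary because two choices are needed: the new vertex
  in the induction over pairs, and the barycenter.\<close>

lemma sum_norm_diff_sq:
  fixes v :: "'b \<Rightarrow> 'a::real_inner"
  shows "(\<Sum>i\<in>A. (norm (v i - c))\<^sup>2) =
    (\<Sum>i\<in>A. (norm (v i))\<^sup>2) - 2 * ((\<Sum>i\<in>A. v i) \<bullet> c) + real (card A) * (norm c)\<^sup>2"
proof -
  have "(norm (v i - c))\<^sup>2 = (norm (v i))\<^sup>2 - 2 * (v i \<bullet> c) + (norm c)\<^sup>2" for i
    by (simp add: power2_norm_eq_inner inner_diff inner_commute)
  then show ?thesis
    by (simp add: sum.distrib sum_subtractf inner_sum_left sum_distrib_left)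
qed

text \<open>Letting \<open>p\<close> run up to \<open>m\<close> only adds an empty row, and it
  avoids the truncated subtraction \<open>m - 1\<close> in the induction.\<close>

lemma sum_pairs_norm_diff_sq:
  fixes v :: "nat \<Rightarrow> 'a::real_inner"
  shows "(\<Sum>p=0..m. \<Sum>q=p+1..m. (norm (v p - v q))\<^sup>2) =
    (real m + 1) * (\<Sum>i=0..m. (norm (v i))\<^sup>2) - (norm (\<Sum>i=0..m. v i))\<^sup>2"
proof (induction m)
  case 0
  then show ?case by simp
next
  case (Suc m)
  \<comment> \<open>Each row \<open>p\<close> \<le> \<open>m\<close> gains the single pair
    (\<open>p\<close>, \<open>Suc m\<close>); the row \<open>p = Suc m\<close> is empty.\<close>
  have "(\<Sum>p=0..Suc m. \<Sum>q=p+1..Suc m. (norm (v p - v q))\<^sup>2) =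
      (\<Sum>p=0..m. (\<Sum>q=p+1..m. (norm (v p - v q))\<^sup>2) + (norm (v p - v (Suc m)))\<^sup>2)"
    by simp
  also have "\<dots> = (\<Sum>p=0..m. \<Sum>q=p+1..m. (norm (v p - v q))\<^sup>2)
      + (\<Sum>p=0..m. (norm (v p - v (Suc m)))\<^sup>2)"
    by (rule sum.distrib)
  finally show ?case
    unfolding Suc.IH sum_norm_diff_sq
    by (simp add: power2_norm_eq_inner inner_add inner_commute algebra_simps)
qed

lemma sum_norm_barycenter_diff_sq:
  fixes v :: "nat \<Rightarrow> 'a::real_inner"
  shows "(\<Sum>i=0..m. (norm (barycenter m v - v i))\<^sup>2) =
    1 / (real m + 1) * (\<Sum>p=0..m. \<Sum>q=p+1..m. (norm (v p - v q))\<^sup>2)"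
proof -
  define s where "s = (\<Sum>i=0..m. v i)"
  define N where "N = real m + 1"
  have N: "N > 0" by (simp add: N_def)
  have b: "barycenter m v = (1 / N) *\<^sub>R s"
    by (simp add: barycenter_def s_def N_def)
  have "(\<Sum>i=0..m. (norm (barycenter m v - v i))\<^sup>2) =
      (\<Sum>i=0..m. (norm (v i))\<^sup>2) - 2 * (s \<bullet> barycenter m v) + N * (norm (barycenter m v))\<^sup>2"
    unfolding norm_minus_commute[of "barycenter m v"] sum_norm_diff_sq
    by (simp add: s_def N_def)
  \<comment> \<open>With \<open>s / N\<close> as barycenter, the cross term is -2 |s|^2 / N and the
    last term is |s|^2 / N; together they leave -|s|^2 / N.\<close>
  also have "\<dots> = 1 / N * (N * (\<Sum>i=0..m. (norm (v i))\<^sup>2) - (norm s)\<^sup>2)"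
    using N unfolding b power2_norm_eq_inner by (simp add: field_simps)
  finally show ?thesis
    unfolding sum_pairs_norm_diff_sq s_def N_def .
qed

text \<open>The vertices other than \<open>v i\<close> sum to (m + 1) b - \<open>v i\<close>, where
  b is the barycenter. Dividing by m and subtracting from \<open>v i\<close> gives (m + 1) / m times
  \<open>v i\<close> - b.\<close>

lemma median_length_eq:
  assumes "1 \<le> m" and "i \<le> m"
  shows "median_length m v i = (real m + 1) / real m * norm (barycenter m v - v i)"
proof -
  have face: "(\<Sum>j\<in>{0..m} - {i}. v j) = (real m + 1) *\<^sub>R barycenter m v - v i"
    using assms by (simp add: sum_diff1 barycenter_def add.commute)
  have "v i - face_barycenter m v i = ((real m + 1) / real m) *\<^sub>R (v i - barycenter m v)"
    using assms unfolding face_barycenter_def face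
    by (simp add: algebra_simps add_divide_distrib)
  then show ?thesis
    by (simp add: median_length_def norm_minus_commute)
qed

theorem theorem2p25:
  fixes m :: nat and v :: "nat \<Rightarrow> real ^ 'n" and \<sigma> :: "(real ^ 'n) set"
  assumes "1 \<le> m" and "m \<le> CARD('n)"
    and "is_simplex m v \<sigma>"
  shows "(\<Sum>i=0..m. (median_length m v i)\<^sup>2) =
           (real m + 1) / (real m)\<^sup>2 * (\<Sum>p=0..m-1. \<Sum>q=p+1..m. (norm (v p - v q))\<^sup>2)
       \<and> (\<Sum>i=0..m. (norm (barycenter m v - v i))\<^sup>2) =
           1 / (real m + 1) * (\<Sum>p=0..m-1. \<Sum>q=p+1..m. (norm (v p - v q))\<^sup>2)"
proof -
  define T where "T = (\<Sum>p=0..m-1. \<Sum>q=p+1..m. (norm (v p - v q))\<^sup>2)"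
  \<comment> \<open>The row \<open>p = m\<close> is empty; 1 \<le> \<open>m\<close> ensures that
    \<open>m - 1\<close> is the true predecessor.\<close>
  have "(\<Sum>p=0..m. \<Sum>q=p+1..m. (norm (v p - v q))\<^sup>2) = T"
    using assms(1) unfolding T_def by (cases m) simp_all
  then have bary: "(\<Sum>i=0..m. (norm (barycenter m v - v i))\<^sup>2) = 1 / (real m + 1) * T"
    using sum_norm_barycenter_diff_sq[of m v] by simp
  have "(\<Sum>i=0..m. (median_length m v i)\<^sup>2) =
      ((real m + 1) / real m)\<^sup>2 * (\<Sum>i=0..m. (norm (barycenter m v - v i))\<^sup>2)"
    using assms(1) by (simp add: median_length_eq power_mult_distrib power_divide sum_distrib_left)
  \<comment> \<open>One factor m + 1 of the squared dilation ratio cancels against 1 / (m + 1) from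
    \<open>bary\<close>.\<close>
  also have "\<dots> = (real m + 1) / (real m)\<^sup>2 * T"
    unfolding bary by (simp add: power2_eq_square)
  finally show ?thesis
    using bary unfolding T_def by blast
qed

end
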